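(* As formal power series in $q$ (equivalently, for complex $q$ with $0<|q|<1$), $$\sum_{n\ge 0}\frac{q^{n^2+n}}{(q;q)_{2n}}=\frac{1}{(q;q)_\infty}\sum_{k\ge 0}L^*_{2k}(1,-q^{-1},q)\,q^{k^2+k}=\frac{1}{(q;q)_\infty}\sum_{k\in\mathbb{Z}}\left(q^{15k^2+2k}-q^{15k^2+8k+1}\right).$$
   Context: $(q;q)_n=\prod_{j=1}^{n}(1-q^j)$, $(q;q)_\infty=\prod_{j\ge1}(1-q^j)$, $\begin{bmatrix} n\\ k\end{bmatrix}=\dfrac{(q;q)_n}{(q;q)_k(q;q)_{n-k}}$ for $0\le k\le n$ (and $0$ otherwise), $[n]=\frac{1-q^n}{1-q}$. The classical Lucas polynomials are given by $L_0(x,s)=2$, $L_1(x,s)=x$, $L_n(x,s)=xL_{n-1}(x,s)+sL_{n-2}(x,s)$. Let $D$ be the $q$-differentiation operator $Df(x)=\dfrac{f(x)-f(qx)}{(1-q)x}$. The $q$-Lucas polynomials are $L_n(x,s,q)=L_n\big(x+(q-1)sD,s\big)1$, i.e. the operator obtained by substituting $x+(q-1)sD$ for $x$ (with $x$ acting as multiplication), applied to the constant polynomial $1$. Explicitly, for $n>0$, $$L_n(x,s,q)=\sum_{k=0}^{\lfloor n/2\rfloor} q^{\binom k2}\frac{[n]}{[n-k]}\begin{bmatrix} n-k\\ k\end{bmatrix}s^kx^{n-2k}.$$ Finally $L_n^*(x,s,q)=L_n(x,s,q)$ for $n>0$ and $L_0^*(x,s,q)=1$; $L^*_{2k}(1,-q^{-1},q)$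 is the value at $x=1$, $s=-q^{-1}$ (a Laurent polynomial in $q$). *)

theory Defs
  imports "HOL-Analysis.Analysis" "HOL-Computational_Algebra.Polynomial"
begin

definition qq :: "complex \<Rightarrow> nat \<Rightarrow> complex"
  where "qq q n = (\<Prod>j=1..n. 1 - q ^ j)"

definition qq_inf :: "complex \<Rightarrow> complex"
  where "qq_inf q = (\<Prod>j. 1 - q ^ Suc j)"

text \<open>Classical Lucas polynomials, as polynomials in \<open>x\<close> with scalar parameter \<open>s\<close>.\<close>

fun lucas :: "nat \<Rightarrow> 'a::field \<Rightarrow> 'a poly" where
  "lucas 0 s = [:2:]"
| "lucas (Suc 0) s = [:0, 1:]"
| "lucas (Suc (Suc n)) s = [:0, 1:] * lucas (Suc n) s + smult s (lucas n s)"

text \<open>\<open>D f(x) = (f(x) - f(qx)) / ((1 - q) x)\<close>. For \<open>q \<noteq> 1\<close> the division is exact, since the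
  numerator has constant term \<open>0\<close>.\<close>

definition qdiff :: "'a::field \<Rightarrow> 'a poly \<Rightarrow> 'a poly"
  where "qdiff q f = (f - pcompose f [:0, q:]) div [:0, 1 - q:]"

definition lucas_op :: "'a::field \<Rightarrow> 'a \<Rightarrow> 'a poly \<Rightarrow> 'a poly"
  where "lucas_op s q f = [:0, 1:] * f + smult ((q - 1) * s) (qdiff q f)"

text \<open>The operator \<open>p(T)\<close> obtained by substituting \<open>T\<close> for the variable of \<open>p\<close>.\<close>

definition poly_at_op :: "'a::field poly \<Rightarrow> ('a poly \<Rightarrow> 'a poly) \<Rightarrow> 'a poly \<Rightarrow> 'a poly"
  where "poly_at_op p T f = (\<Sum>i\<le>degree p. smult (coeff p i) ((T ^^ i) f))"

definition qlucas :: "nat \<Rightarrow> 'a::field \<Rightarrow> 'a \<Rightarrow> 'a \<Rightarrow> 'a"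
  where "qlucas n x s q = poly (poly_at_op (lucas n s) (lucas_op s q) 1) x"

definition qlucas_star :: "nat \<Rightarrow> 'a::field \<Rightarrow> 'a \<Rightarrow> 'a \<Rightarrow> 'a"
  where "qlucas_star n x s q = (if n = 0 then 1 else qlucas n x s q)"

end

theory Submission imports Defs begin

text \<open>
  Write \<open>L(r)\<close> for the value \<open>L*\<^sub>2\<^sub>r(1, -1/q, q)\<close>. As operators \<open>x = T - (q - 1) s D\<close> with
  \<open>T = x + (q - 1) s D\<close>, and the three-term recurrence of the Lucas polynomials in \<open>T\<close> then expands
  \<open>x\<^sup>2\<^sup>n\<close> in \<open>q\<close>-Lucas polynomials with Gaussian binomial coefficients; at \<open>x = 1\<close>, \<open>s = -1/q\<close> this reads
  \<open>q\<^sup>n = \<Sum>r\<le>n. q\<^sup>r L(r) [2n, n-r]\<close>.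
  The bilateral sum \<open>\<Sum>j. q powi (6j\<^sup>2+2j) ([2n, n-3j] - [2n, n-3j-1])\<close> is also \<open>q\<^sup>n\<close>, by \<open>q\<close>-Pascal
  recurrences linking it to a companion sum with odd upper index. Both systems have the same unitriangular
  matrix, so \<open>q\<^sup>r L(r)\<close> is obtained by collecting the terms with \<open>\<bar>3j\<bar> = r\<close> or \<open>\<bar>3j+1\<bar> = r\<close>; since
  \<open>(6j\<^sup>2+2j) + (3j)\<^sup>2 = 15j\<^sup>2+2j\<close> and \<open>(6j\<^sup>2+2j) + (3j+1)\<^sup>2 = 15j\<^sup>2+8j+1\<close>, weighting by
  \<open>q\<close> to the power \<open>r\<^sup>2\<close> gives the second equality.
  For the first, divide the expansion by \<open>(q;q)\<^sub>2\<^sub>n\<close>, weight it by \<open>q\<close> to the power \<open>n\<^sup>2\<close>, sum over \<open>n\<close> and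
  interchange: the inner sums are Durfee rectangle sums, all equal to \<open>1/(q;q)\<^sub>\<infinity>\<close>.
\<close>

section \<open>Gaussian binomial coefficients\<close>

text \<open>An integer lower index, with value 0 outside the range, makes the recurrences below hold
  for every \<open>k\<close> without side conditions, so that bilateral sums can be shifted
  freely.\<close>

definition gbinom :: "complex \<Rightarrow> nat \<Rightarrow> int \<Rightarrow> complex" where
  "gbinom q n k =
    (if 0 \<le> k \<and> k \<le> int n then qq q n / (qq q (nat k) * qq q (n - nat k)) else 0)"

lemma qq_0 [simp]: "qq q 0 = 1"
  by (simp add: qq_def)

lemma qq_Suc: "qq q (Suc n) = qq q n * (1 - q ^ Suc n)"
  by (simp add: qq_def)

lemma one_minus_power_nonzero:
  fixes q :: complex
  assumes "norm q < 1" "n > 0"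
  shows "1 - q ^ n \<noteq> 0"
proof
  assume "1 - q ^ n = 0"
  then have "norm q ^ n = 1"
    by (metis eq_iff_diff_eq_0 norm_one norm_power)
  with assms show False
    using power_strict_mono[of "norm q" 1 n] by simp
qed

lemma qq_nonzero:
  assumes "norm q < 1"
  shows "qq q n \<noteq> 0"
  using one_minus_power_nonzero[OF assms] by (auto simp: qq_def)

lemma gbinom_eq_0: "k < 0 \<or> k > int n \<Longrightarrow> gbinom q n k = 0"
  by (auto simp: gbinom_def)

lemma gbinom_sym: "gbinom q n (int n - k) = gbinom q n k"
proof (cases "0 \<le> k \<and> k \<le> int n")
  case True
  then obtain i where k: "k = int i" "i \<le> n"
    by (metis of_nat_le_iff zero_le_imp_eq_int)
  have "int n - int i = int (n - i)"
    using k by simp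
  with k show ?thesis
    by (simp add: gbinom_def mult.commute del: of_nat_diff)
qed (auto simp: gbinom_def)

lemma gbinom_0_right: "norm q < 1 \<Longrightarrow> gbinom q n 0 = 1"
  by (simp add: gbinom_def qq_nonzero)

text \<open>The q-analogue of k C(n+1, k) = (n+1) C(n, k-1). At \<open>k = 0\<close> both sides
  vanish, the left one through its factor. Both Pascal rules are derived from this identity.\<close>

lemma gbinom_absorb:
  assumes "norm q < 1"
  shows "(1 - q powi k) * gbinom q (Suc n) k = (1 - q ^ Suc n) * gbinom q n (k - 1)"
proof -
  consider "k \<le> 0" | "k > int n + 1" | i where "k = int (Suc i)" "i \<le> n"
  proof -
    have "k = int (Suc (nat (k - 1))) \<and> nat (k - 1) \<le> n" if "\<not> k \<le> 0" "\<not> k > int n + 1"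
      using that by auto
    then show thesis
      using that by blast
  qed
  then show ?thesis
  proof cases
    case 3
    have ki: "k - 1 = int i" "nat (int (Suc i)) = Suc i"
      using 3 by simp_all
    have "1 - q ^ Suc i \<noteq> 0"
      by (rule one_minus_power_nonzero[OF assms]) simp
    then show ?thesis
      using 3 qq_nonzero[OF assms, of i] qq_nonzero[OF assms, of "n - i"]
      unfolding ki unfolding 3(1)
      by (simp add: gbinom_def ki qq_Suc field_simps nat_add_distrib del: power_Suc of_nat_Suc)
  qed (auto simp: gbinom_def)
qed

lemma gbinom_absorb':
  assumes "norm q < 1"
  shows "(1 - q powi (int n + 1 - k)) * gbinom q (Suc n) k = (1 - q ^ Suc n) * gbinom q n k"
  using gbinom_absorb[OF assms, of "int n + 1 - k" n] gbinom_sym[of q "Suc n" k] gbinom_sym[of q n k]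
  by (simp add: algebra_simps)

text \<open>Split 1 - q^(n+1) = (1 - q^k) + q^k (1 - q^(n+1-k)), absorb each part, and cancel the
  nonzero factor 1 - q^(n+1).\<close>

lemma gbinom_pascal:
  assumes "norm q < 1" "q \<noteq> 0"
  shows "gbinom q (Suc n) k = gbinom q n (k - 1) + q powi k * gbinom q n k"
proof -
  have "(1 - q ^ Suc n) * gbinom q (Suc n) k =
      (1 - q powi k) * gbinom q (Suc n) k + q powi k * ((1 - q powi (int n + 1 - k)) * gbinom q (Suc n) k)"
  proof -
    have "q powi k * q powi (int n + 1 - k) = q powi (int (Suc n))"
      using assms(2) by (simp flip: power_int_add add: algebra_simps)
    then have "q powi k * q powi (int n + 1 - k) = q ^ Suc n"
      by (simp only: power_int_of_nat)
    then show ?thesis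
      by (simp add: algebra_simps)
  qed
  also have "\<dots> = (1 - q ^ Suc n) * (gbinom q n (k - 1) + q powi k * gbinom q n k)"
    unfolding gbinom_absorb[OF assms(1)] gbinom_absorb'[OF assms(1)] by (simp add: algebra_simps)
  finally show ?thesis
    using one_minus_power_nonzero[OF assms(1), of "Suc n"] by simp
qed

lemma gbinom_pascal':
  assumes "norm q < 1" "q \<noteq> 0"
  shows "gbinom q (Suc n) k = q powi (int n + 1 - k) * gbinom q n (k - 1) + gbinom q n k"
  using gbinom_pascal[OF assms, of n "int n + 1 - k"] gbinom_sym[of q "Suc n" k]
    gbinom_sym[of q n k] gbinom_sym[of q n "k - 1"]
  by (simp add: algebra_simps)

text \<open>By injectivity only finitely many \<open>f j\<close> lie in the range 0..n, so the sum
  is finite whatever the weights \<open>c\<close>.\<close>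

lemma gbinom_summable:
  fixes c :: "int \<Rightarrow> complex"
  assumes "inj f"
  shows "(\<lambda>j. c j * gbinom q n (f j)) summable_on UNIV"
proof (rule finite_nonzero_values_imp_summable_on)
  have "finite (f -` {0..int n})"
    using assms by (intro finite_vimageI) auto
  then show "finite {j \<in> UNIV. c j * gbinom q n (f j) \<noteq> 0}"
    by (rule rev_finite_subset) (auto simp: gbinom_def)
qed

lemma infsum_shift: "(\<Sum>\<^sub>\<infinity>j\<in>UNIV. f (j + c :: int)) = (\<Sum>\<^sub>\<infinity>j\<in>UNIV. f j)"
  by (rule infsum_reindex_bij_witness[where i = "\<lambda>j. j - c" and j = "\<lambda>j. j + c"]) auto

section \<open>A bilateral sum of Gaussian binomials\<close>

lemma has_sum_diff:
  fixes f g :: "'a \<Rightarrow> 'b::topological_ab_group_add"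
  assumes "(f has_sum a) A" "(g has_sum b) A"
  shows "((\<lambda>x. f x - g x) has_sum (a - b)) A"
  using has_sum_add[OF assms(1), of "\<lambda>x. - g x" "- b"] assms(2) by (simp add: has_sum_uminus)

lemma summable_on_diff:
  fixes f g :: "'a \<Rightarrow> 'b::topological_ab_group_add"
  assumes "f summable_on A" "g summable_on A"
  shows "(\<lambda>x. f x - g x) summable_on A"
  using assms has_sum_diff unfolding summable_on_def by blast

lemma infsum_diff:
  fixes f g :: "'a \<Rightarrow> 'b::{topological_ab_group_add, t2_space}"
  assumes "f summable_on A" "g summable_on A"
  shows "(\<Sum>\<^sub>\<infinity>x\<in>A. f x - g x) = infsum f A - infsum g A"
  using assms by (intro infsumI has_sum_diff has_sum_infsum)

text \<open>\<open>A\<close> is the sum to be evaluated; \<open>B\<close> is its companion with odd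
  upper index. One Pascal step leads from \<open>A (Suc n)\<close> to \<open>B n\<close>. A second
  one splits \<open>A (Suc n)\<close> off \<open>B (Suc n)\<close>, and absorption turns the rest
  into \<open>B n\<close>.\<close>

lemma bilateral_gbinom_even_odd:
  fixes q :: complex
  assumes q: "norm q < 1" "q \<noteq> 0"
  defines "A \<equiv> \<lambda>n. \<Sum>\<^sub>\<infinity>j\<in>UNIV. q powi (6 * j\<^sup>2 + 2 * j) *
    (gbinom q (2 * n) (int n - 3 * j) - gbinom q (2 * n) (int n - 3 * j - 1))"
  defines "B \<equiv> \<lambda>n. \<Sum>\<^sub>\<infinity>j\<in>UNIV. q powi (6 * j\<^sup>2 - j) * gbinom q (2 * n + 1) (int n + 1 - 3 * j) -
    q powi (6 * j\<^sup>2 + 5 * j + 1) * gbinom q (2 * n + 1) (int n - 1 - 3 * j)"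
  shows "A (Suc n) = q ^ Suc n * B n"
    and "B (Suc n) = q ^ Suc n * A (Suc n) + (1 - q ^ (2 * n + 2)) * B n"
proof -
  have powi: "q powi a * q powi b = q powi (a + b)" for a b
    using q by (simp add: power_int_add)
  have powi': "q powi a * (q powi b * x) = q powi (a + b) * x" for a b x
    by (simp flip: powi)
  note P = gbinom_pascal[OF q] and P' = gbinom_pascal'[OF q]
  have qn: "q ^ Suc n = q powi (int n + 1)"
    by (metis of_nat_1 of_nat_add Suc_eq_plus1 power_int_of_nat)
  have inj: "inj (\<lambda>j. c - 3 * j)" for c :: int
    by (auto simp: inj_def)
  note S = gbinom_summable[OF inj]
  have "A (Suc n) = (\<Sum>\<^sub>\<infinity>j\<in>UNIV. q ^ Suc n * (q powi (6 * j\<^sup>2 - j) * gbinom q (2 * n + 1) (int n + 1 - 3 * j) -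
    q powi (6 * j\<^sup>2 + 5 * j + 1) * gbinom q (2 * n + 1) (int n - 1 - 3 * j)))"
    unfolding A_def
  proof (intro infsum_cong)
    fix j :: int
    \<comment> \<open>The two Pascal rules are chosen so that both expansions contain the same term
      with lower index n - 3j and weight 1, which cancels in the difference.\<close>
    have 1: "gbinom q (2 * Suc n) (int (Suc n) - 3 * j) =
      gbinom q (2 * n + 1) (int n - 3 * j) + q powi (int n + 1 - 3 * j) * gbinom q (2 * n + 1) (int n + 1 - 3 * j)"
      using P[of "2 * n + 1" "int n + 1 - 3 * j"] by (simp add: algebra_simps)
    have 2: "gbinom q (2 * Suc n) (int (Suc n) - 3 * j - 1) =
      q powi (int n + 2 + 3 * j) * gbinom q (2 * n + 1) (int n - 1 - 3 * j) + gbinom q (2 * n + 1) (int n - 3 * j)"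
      using P'[of "2 * n + 1" "int n - 3 * j"] by (simp add: algebra_simps)
    show "q powi (6 * j\<^sup>2 + 2 * j) * (gbinom q (2 * Suc n) (int (Suc n) - 3 * j)
      - gbinom q (2 * Suc n) (int (Suc n) - 3 * j - 1)) =
      q ^ Suc n * (q powi (6 * j\<^sup>2 - j) * gbinom q (2 * n + 1) (int n + 1 - 3 * j) -
    q powi (6 * j\<^sup>2 + 5 * j + 1) * gbinom q (2 * n + 1) (int n - 1 - 3 * j))"
      unfolding 1 2 qn by (simp add: ring_distribs powi powi' algebra_simps)
  qed
  also have "\<dots> = q ^ Suc n * B n"
    unfolding B_def by (rule infsum_cmult_right')
  finally show "A (Suc n) = q ^ Suc n * B n" .

  define r1 where "r1 = (\<lambda>j. q powi (6 * j\<^sup>2 - j) * gbinom q (2 * n + 2) (int n + 2 - 3 * j))"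
  define r2 where "r2 = (\<lambda>j. q powi (6 * j\<^sup>2 + 5 * j + 1) * gbinom q (2 * n + 2) (int n - 1 - 3 * j))"
  define r3 where "r3 = (\<lambda>j. q powi (6 * j\<^sup>2 - j) * gbinom q (2 * n + 1) (int n + 1 - 3 * j))"
  define r4 where "r4 = (\<lambda>j. q powi (6 * j\<^sup>2 + 5 * j + 1) * gbinom q (2 * n + 1) (int n - 1 - 3 * j))"
  define r5 where "r5 = (\<lambda>j. q powi (6 * j\<^sup>2 - 7 * j + 2) * gbinom q (2 * n + 2) (int n + 2 - 3 * j))"
  define r6 where "r6 = (\<lambda>j. q powi (6 * j\<^sup>2 - 7 * j + 2) * gbinom q (2 * n + 1) (int n + 2 - 3 * j))"
  have r: "r1 summable_on UNIV" "r2 summable_on UNIV" "r3 summable_on UNIV" "r4 summable_on UNIV"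
     "r5 summable_on UNIV" "r6 summable_on UNIV"
    unfolding r1_def r2_def r3_def r4_def r5_def r6_def by (rule S)+
  \<comment> \<open>Shifting \<open>j\<close> by one brings the second family to the lower index n +
    2 - 3j, where it can be combined with \<open>r1\<close> under a common Gaussian
    binomial.\<close>
  have r2: "infsum r2 UNIV = infsum r5 UNIV"
  proof -
    have "r5 (j + 1) = r2 j" for j
      by (simp add: r5_def r2_def power2_eq_square algebra_simps)
    then show ?thesis
      using infsum_shift[of r5 1] by simp
  qed
  have r4: "infsum r4 UNIV = infsum r6 UNIV"
  proof -
    have "r6 (j + 1) = r4 j" for j
      by (simp add: r6_def r4_def power2_eq_square algebra_simps)
    then show ?thesis
      using infsum_shift[of r6 1] by simp
  qed
  have "B (Suc n) = (\<Sum>\<^sub>\<infinity>j\<in>UNIV. q ^ Suc n * (q powi (6 * j\<^sup>2 + 2 * j) *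
    (gbinom q (2 * Suc n) (int (Suc n) - 3 * j) - gbinom q (2 * Suc n) (int (Suc n) - 3 * j - 1)))
     + (r1 j - r2 j))"
    unfolding B_def
  proof (intro infsum_cong)
    fix j :: int
    have 1: "gbinom q (2 * Suc n + 1) (int (Suc n) + 1 - 3 * j) =
      q powi (int n + 1 + 3 * j) * gbinom q (2 * n + 2) (int n + 1 - 3 * j) + gbinom q (2 * n + 2) (int n + 2 - 3 * j)"
      using P'[of "2 * n + 2" "int n + 2 - 3 * j"] by (simp add: algebra_simps)
    have 2: "gbinom q (2 * Suc n + 1) (int (Suc n) - 1 - 3 * j) =
      gbinom q (2 * n + 2) (int n - 1 - 3 * j) + q powi (int n - 3 * j) * gbinom q (2 * n + 2) (int n - 3 * j)"
      using P[of "2 * n + 2" "int n - 3 * j"] by (simp add: algebra_simps)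
    show "q powi (6 * j\<^sup>2 - j) * gbinom q (2 * Suc n + 1) (int (Suc n) + 1 - 3 * j) -
    q powi (6 * j\<^sup>2 + 5 * j + 1) * gbinom q (2 * Suc n + 1) (int (Suc n) - 1 - 3 * j) =
     q ^ Suc n * (q powi (6 * j\<^sup>2 + 2 * j) *
    (gbinom q (2 * Suc n) (int (Suc n) - 3 * j) - gbinom q (2 * Suc n) (int (Suc n) - 3 * j - 1)))
     + (r1 j - r2 j)"
      unfolding 1 2 qn r1_def r2_def by (simp add: ring_distribs powi powi' algebra_simps)
  qed
  also have "\<dots> = q ^ Suc n * A (Suc n) + (infsum r1 UNIV - infsum r2 UNIV)"
  proof -
    have "(\<lambda>j. q powi (6 * j\<^sup>2 + 2 * j) * (gbinom q (2 * Suc n) (int (Suc n) - 3 * j) -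
        gbinom q (2 * Suc n) (int (Suc n) - 3 * j - 1))) summable_on UNIV"
      unfolding right_diff_distrib
      by (intro summable_on_diff gbinom_summable) (auto simp: inj_def)
    then show ?thesis
      unfolding A_def
      by (subst infsum_add) (simp_all only: infsum_cmult_right' infsum_diff r summable_on_cmult_right summable_on_diff)
  qed
  also have "infsum r1 UNIV - infsum r2 UNIV = (\<Sum>\<^sub>\<infinity>j\<in>UNIV. r1 j - r5 j)"
    unfolding r2 by (simp add: infsum_diff r)
  also have "\<dots> = (\<Sum>\<^sub>\<infinity>j\<in>UNIV. (1 - q ^ (2 * n + 2)) * (r3 j - r6 j))"
  proof (intro infsum_cong)
    fix j :: int
    define k where "k = int n + 2 - 3 * j"
    have 1: "(1 - q powi k) * gbinom q (2 * n + 2) k = (1 - q ^ (2 * n + 2)) * gbinom q (2 * n + 1) (k - 1)"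
      using gbinom_absorb[OF q(1), of k "2 * n + 1"] by simp
    have 2: "(1 - q powi (2 * int n + 2 - k)) * gbinom q (2 * n + 2) k = (1 - q ^ (2 * n + 2)) * gbinom q (2 * n + 1) k"
      using gbinom_absorb'[OF q(1), of "2 * n + 1" k] by (simp add: add.commute)
    \<comment> \<open>The factors required for absorption are inserted here; the extra terms cancel
      because (2 - 6j) + (2n + 2 - k) = k.\<close>
    have "r1 j - r5 j = q powi (6 * j\<^sup>2 - j) *
      (((1 - q powi k) * gbinom q (2 * n + 2) k) - q powi (2 - 6 * j) * ((1 - q powi (2 * int n + 2 - k)) * gbinom q (2 * n + 2) k))"
      unfolding r1_def r5_def by (simp add: k_def ring_distribs powi' powi algebra_simps)
    also have "\<dots> = (1 - q ^ (2 * n + 2)) * (r3 j - r6 j)"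
      unfolding 1 2 r3_def r6_def by (simp add: k_def ring_distribs powi powi' algebra_simps)
    finally show "r1 j - r5 j = (1 - q ^ (2 * n + 2)) * (r3 j - r6 j)" .
  qed
  also have "\<dots> = (1 - q ^ (2 * n + 2)) * (infsum r3 UNIV - infsum r6 UNIV)"
    by (simp add: infsum_cmult_right' infsum_diff r)
  also have "infsum r3 UNIV - infsum r6 UNIV = B n"
    unfolding B_def r4[symmetric] by (simp add: infsum_diff[symmetric] r) (simp add: r3_def r4_def)
  finally show "B (Suc n) = q ^ Suc n * A (Suc n) + (1 - q ^ (2 * n + 2)) * B n" .
qed

text \<open>The recurrences collapse: if \<open>B n = 1\<close>, then B(n+1) = q^(2n+2) + (1 -
  q^(2n+2)) = 1, and \<open>A\<close> follows. For \<open>n = 0\<close> only the term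
  \<open>j = 0\<close> survives.\<close>

lemma bilateral_gbinom:
  fixes q :: complex
  assumes q: "norm q < 1" "q \<noteq> 0"
  shows "(\<Sum>\<^sub>\<infinity>j\<in>UNIV. q powi (6 * j\<^sup>2 + 2 * j) *
    (gbinom q (2 * n) (int n - 3 * j) - gbinom q (2 * n) (int n - 3 * j - 1))) = q ^ n"
proof -
  define A where "A = (\<lambda>n. \<Sum>\<^sub>\<infinity>j\<in>UNIV. q powi (6 * j\<^sup>2 + 2 * j) *
    (gbinom q (2 * n) (int n - 3 * j) - gbinom q (2 * n) (int n - 3 * j - 1)))"
  define B where "B = (\<lambda>n. \<Sum>\<^sub>\<infinity>j\<in>UNIV. q powi (6 * j\<^sup>2 - j) * gbinom q (2 * n + 1) (int n + 1 - 3 * j) -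
    q powi (6 * j\<^sup>2 + 5 * j + 1) * gbinom q (2 * n + 1) (int n - 1 - 3 * j))"
  have AB: "A (Suc n) = q ^ Suc n * B n"
    "B (Suc n) = q ^ Suc n * A (Suc n) + (1 - q ^ (2 * n + 2)) * B n" for n
    unfolding A_def B_def by (rule bilateral_gbinom_even_odd[OF q])+
  have single: "(\<Sum>\<^sub>\<infinity>j\<in>UNIV. f j) = f 0" if "\<And>j. j \<noteq> 0 \<Longrightarrow> f j = 0" for f :: "int \<Rightarrow> complex"
    using infsum_cong_neutral[of "{0}" UNIV f f] that by simp
  have A0: "A 0 = 1"
    unfolding A_def by (subst single) (auto simp: gbinom_def)
  have B0: "B 0 = 1"
    unfolding B_def using q by (subst single) (auto simp: gbinom_def qq_nonzero)
  have B: "B n = 1" for n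
  proof (induction n)
    case (Suc n)
    have "B (Suc n) = q ^ Suc n * q ^ Suc n + (1 - q ^ (2 * n + 2))"
      using AB[of n] Suc by (simp only: mult_1_right)
    also have "\<dots> = 1"
      by (simp add: mult_2 power_add)
    finally show ?case .
  qed (fact B0)
  have "A n = q ^ n"
    using A0 AB(1) B by (cases n) auto
  then show ?thesis
    by (simp add: A_def)
qed

section \<open>Expanding powers in q-Lucas polynomials\<close>

lemma qdiff_add: "qdiff q (f + g) = qdiff q f + qdiff q g"
  unfolding qdiff_def pcompose_add by (simp flip: poly_div_add_left add: algebra_simps)

lemma qdiff_smult: "qdiff q (smult c f) = smult c (qdiff q f)"
  unfolding qdiff_def pcompose_smult by (simp flip: div_smult_left add: smult_diff_right)

lemma qdiff_monom:
  assumes "q \<noteq> 1"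
  shows "qdiff q (monom 1 n) = monom ((1 - q ^ n) / (1 - q)) (n - 1)"
proof -
  have "monom 1 n - pcompose (monom 1 n) [:0, q:] = monom (1 - q ^ n) n"
    by (intro poly_eqI) (simp add: coeff_pcompose_linear)
  also have "\<dots> = monom ((1 - q ^ n) / (1 - q)) (n - 1) * [:0, 1 - q:]"
    using assms by (cases n) (simp_all flip: monom_Suc monom_0 add: mult_monom)
  finally show ?thesis
    unfolding qdiff_def using assms by (simp only:) (rule nonzero_mult_div_cancel_right, simp)
qed

lemma lucas_op_add: "lucas_op s q (f + g) = lucas_op s q f + lucas_op s q g"
  by (simp add: lucas_op_def qdiff_add ring_distribs smult_add_right)

lemma lucas_op_smult: "lucas_op s q (smult c f) = smult c (lucas_op s q f)"
  by (simp add: lucas_op_def qdiff_smult smult_add_right mult.commute)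

lemma lucas_op_0: "lucas_op s q 0 = 0"
  by (metis lucas_op_smult smult_0_left)

lemma lucas_op_sum: "lucas_op s q (\<Sum>i\<in>A. f i) = (\<Sum>i\<in>A. lucas_op s q (f i))"
  using sum_comp_morphism[of "lucas_op s q" f A] by (simp add: lucas_op_0 lucas_op_add o_def)

text \<open>The factor q - 1 of the operator cancels the denominator of [n]. Read backwards, this is
  a three-term recurrence for the powers of x; at \<open>n = 0\<close> the truncated exponent occurs
  with coefficient 0.\<close>

lemma lucas_op_monom:
  assumes "q \<noteq> 1"
  shows "lucas_op s q (monom 1 n) = monom 1 (Suc n) - smult (s * (1 - q ^ n)) (monom 1 (n - 1))"
proof -
  have "(q - 1) * ((1 - q ^ n) / (1 - q)) = - (1 - q ^ n)"
    using assms by (simp add: field_simps)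
  then have "s * ((q - 1) * ((1 - q ^ n) / (1 - q))) = - (s * (1 - q ^ n))"
    by (simp only: mult_minus_right)
  then have "(q - 1) * s * ((1 - q ^ n) / (1 - q)) = - (s * (1 - q ^ n))"
    by (simp only: mult_ac)
  then show ?thesis
    by (simp add: lucas_op_def qdiff_monom[OF assms] smult_monom monom_Suc minus_monom)
qed

section \<open>Substituting an operator into the Lucas polynomials\<close>

lemma poly_at_op_altdef:
  assumes "degree p \<le> n"
  shows "poly_at_op p T f = (\<Sum>i\<le>n. smult (coeff p i) ((T ^^ i) f))"
  unfolding poly_at_op_def using assms
  by (intro sum.mono_neutral_left) (auto simp: coeff_eq_0)

lemma poly_at_op_add: "poly_at_op (p + r) T f = poly_at_op p T f + poly_at_op r T f"
  by (simp add: poly_at_op_altdef[of _ "max (degree p) (degree r)"] degree_add_le_max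
      smult_add_left sum.distrib)

lemma smult_sum_right: "smult c (\<Sum>i\<in>A. g i) = (\<Sum>i\<in>A. smult c (g i))"
  by (induction A rule: infinite_finite_induct) (simp_all add: smult_add_right)

lemma poly_at_op_smult: "poly_at_op (smult c p) T f = smult c (poly_at_op p T f)"
  by (simp add: poly_at_op_altdef[of _ "degree p"] smult_sum_right)

lemma poly_at_lucas_op_shift:
  "poly_at_op ([:0, 1:] * p) (lucas_op s q) f = lucas_op s q (poly_at_op p (lucas_op s q) f)"
proof -
  have "poly_at_op ([:0, 1:] * p) (lucas_op s q) f =
      (\<Sum>i\<le>Suc (degree p). smult (coeff (pCons 0 p) i) ((lucas_op s q ^^ i) f))"
    by (subst poly_at_op_altdef[of _ "Suc (degree p)"]) (auto simp: degree_pCons_le)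
  also have "\<dots> = lucas_op s q (poly_at_op p (lucas_op s q) f)"
    by (subst sum.atMost_Suc_shift) (simp add: poly_at_op_def lucas_op_sum lucas_op_smult)
  finally show ?thesis .
qed

text \<open>If \<open>\<alpha> + \<beta> = T\<close> and \<open>\<alpha> \<beta> = -s\<close>, then \<open>lucas_pair s q i j\<close> is \<open>\<alpha>\<^sup>i \<beta>\<^sup>j + \<alpha>\<^sup>j \<beta>\<^sup>i\<close> applied to \<open>1\<close>. Of the two
  truncated differences \<open>i - j\<close> and \<open>j - i\<close> one vanishes and the other is \<open>\<bar>i - j\<bar>\<close>.\<close>

definition lucas_pair :: "'a::field \<Rightarrow> 'a \<Rightarrow> nat \<Rightarrow> nat \<Rightarrow> 'a poly" where
  "lucas_pair s q i j =
    smult ((- s) ^ min i j) (poly_at_op (lucas ((i - j) + (j - i)) s) (lucas_op s q) 1)"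

lemma lucas_pair_Suc_Suc: "lucas_pair s q (Suc i) (Suc j) = smult (- s) (lucas_pair s q i j)"
  by (simp add: lucas_pair_def)

lemma lucas_pair_sym: "lucas_pair s q i j = lucas_pair s q j i"
  by (simp add: lucas_pair_def min.commute add.commute)

lemma poly_at_op_lucas_0: "poly_at_op (lucas 0 s) (lucas_op s q) f = smult 2 f"
  by (simp add: poly_at_op_def)

lemma poly_at_op_lucas_1: "poly_at_op (lucas (Suc 0) s) (lucas_op s q) f = lucas_op s q f"
  by (simp add: poly_at_op_def)

text \<open>This is multiplication by \<alpha> + \<beta>. For distinct indices it is the Lucas
  recurrence in T; for equal ones, L_0 = 2 supplies the two equal summands.\<close>

lemma lucas_op_pair:
  "lucas_op s q (lucas_pair s q i j) = lucas_pair s q (Suc i) j + lucas_pair s q i (Suc j)"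
proof -
  have less: "lucas_op s q (lucas_pair s q i j) = lucas_pair s q (Suc i) j + lucas_pair s q i (Suc j)"
    if "i < j" for i j
  proof -
    obtain d where j: "j = i + Suc d"
      using \<open>i < j\<close> less_imp_add_positive[of i j] gr0_conv_Suc by auto
    let ?L = "\<lambda>n. poly_at_op (lucas n s) (lucas_op s q) 1"
    have "?L (Suc (Suc d)) = lucas_op s q (?L (Suc d)) + smult s (?L d)"
      by (simp only: lucas.simps poly_at_op_add poly_at_op_smult poly_at_lucas_op_shift)
    then have "lucas_op s q (?L (Suc d)) = ?L (Suc (Suc d)) - smult s (?L d)"
      by simp
    then show ?thesis
      by (simp add: lucas_pair_def j lucas_op_smult smult_diff_right mult.commute del: lucas.simps)
  qed
  show ?thesis
  proof (cases i j rule: linorder_cases)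
    case less
    then show ?thesis by (rule \<open>\<And>j i. i < j \<Longrightarrow> _ i j\<close>)
  next
    case equal
    have 2: "smult 2 f = f + f" for f :: "'a poly"
      using smult_add_left[of 1 1 f] by simp
    have "lucas_pair s q i i = smult ((- s) ^ i) (1 + 1)"
      by (simp add: lucas_pair_def poly_at_op_lucas_0 numeral_poly mult.commute del: lucas.simps)
    moreover have "lucas_pair s q (Suc i) i = smult ((- s) ^ i) (lucas_op s q 1)"
      by (simp add: lucas_pair_def poly_at_op_lucas_1 del: lucas.simps)
    ultimately show ?thesis
      unfolding equal[symmetric] lucas_pair_sym[of s q i "Suc i"]
      by (simp only: lucas_op_smult lucas_op_add smult_add_right)
  next
    case greater
    then show ?thesis
      using less[of j i] by (simp add: lucas_pair_sym[of s q i] lucas_pair_sym[of s q "Suc i"] add.commute)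
  qed
qed

text \<open>Pascal's rule with q^k written as 1 - (1 - q^k) and the second part absorbed. The
  coefficients no longer depend on \<open>k\<close>, so the recurrence passes to sums over
  \<open>k\<close>.\<close>

lemma gbinom_lucas_recurrence:
  assumes "norm q < 1" "q \<noteq> 0"
  shows "gbinom q (Suc (Suc n)) k =
    gbinom q (Suc n) (k - 1) + gbinom q (Suc n) k - (1 - q ^ Suc n) * gbinom q n (k - 1)"
  using gbinom_pascal[OF assms, of "Suc n" k] gbinom_absorb[OF assms(1), of k n]
  by (simp add: algebra_simps)

text \<open>Up to the symmetrisation that produces the 2, the sum is the homogeneous Rogers-Szego
  polynomial in \<alpha> and \<beta>. Its recurrence is the one that \<open>lucas_op_monom\<close>
  gives for the powers of x, and the initial values agree.\<close>

lemma gbinom_lucas_pair_sum: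
  assumes q: "norm q < 1" "q \<noteq> 0"
  shows "(\<Sum>i\<le>n. smult (gbinom q n (int i)) (lucas_pair s q i (n - i))) = smult 2 (monom 1 n)"
proof -
  define S where "S n = (\<Sum>i\<le>n. smult (gbinom q n (int i)) (lucas_pair s q i (n - i)))" for n
  have q1: "q \<noteq> 1"
    using q by auto
  have rec: "S (Suc (Suc n)) = lucas_op s q (S (Suc n)) + smult (s * (1 - q ^ Suc n)) (S n)" for n
  proof -
    have "S (Suc (Suc n)) =
      (\<Sum>i\<le>Suc (Suc n). smult (gbinom q (Suc n) (int i - 1)) (lucas_pair s q i (Suc (Suc n) - i))) +
      (\<Sum>i\<le>Suc (Suc n). smult (gbinom q (Suc n) (int i)) (lucas_pair s q i (Suc (Suc n) - i))) -
      (\<Sum>i\<le>Suc (Suc n). smult ((1 - q ^ Suc n) * gbinom q n (int i - 1)) (lucas_pair s q i (Suc (Suc n) - i)))"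
      unfolding S_def gbinom_lucas_recurrence[OF q]
      by (simp only: smult_add_left smult_diff_left sum.distrib sum_subtractf)
    \<comment> \<open>The first two sums raise one exponent of the pair and together form T applied
      to the previous sum; the third raises both, which contributes \<alpha>\<beta> = -s.\<close>
    also have "(\<Sum>i\<le>Suc (Suc n). smult (gbinom q (Suc n) (int i - 1)) (lucas_pair s q i (Suc (Suc n) - i))) =
      (\<Sum>i\<le>Suc n. smult (gbinom q (Suc n) (int i)) (lucas_pair s q (Suc i) (Suc n - i)))"
      by (subst sum.atMost_Suc_shift) (simp add: gbinom_eq_0)
    also have "(\<Sum>i\<le>Suc (Suc n). smult (gbinom q (Suc n) (int i)) (lucas_pair s q i (Suc (Suc n) - i))) =
      (\<Sum>i\<le>Suc n. smult (gbinom q (Suc n) (int i)) (lucas_pair s q i (Suc (Suc n - i))))"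
      by (subst sum.atMost_Suc) (simp add: gbinom_eq_0 Suc_diff_le del: sum.atMost_Suc)
    also have "(\<Sum>i\<le>Suc (Suc n). smult ((1 - q ^ Suc n) * gbinom q n (int i - 1)) (lucas_pair s q i (Suc (Suc n) - i))) =
      (\<Sum>i\<le>n. smult ((1 - q ^ Suc n) * gbinom q n (int i)) (lucas_pair s q (Suc i) (Suc n - i)))"
      by (subst sum.atMost_Suc_shift, subst sum.atMost_Suc) (simp add: gbinom_eq_0 del: sum.atMost_Suc)
    also have "\<dots> = - smult (s * (1 - q ^ Suc n)) (S n)"
      unfolding S_def
      by (simp add: sum_negf[symmetric] smult_sum_right Suc_diff_le lucas_pair_Suc_Suc mult_ac del: power_Suc)
    also have "(\<Sum>i\<le>Suc n. smult (gbinom q (Suc n) (int i)) (lucas_pair s q (Suc i) (Suc n - i))) +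
      (\<Sum>i\<le>Suc n. smult (gbinom q (Suc n) (int i)) (lucas_pair s q i (Suc (Suc n - i)))) =
      lucas_op s q (S (Suc n))"
      unfolding S_def
      by (simp only: lucas_op_sum lucas_op_smult lucas_op_pair smult_add_right sum.distrib)
    finally show ?thesis
      by simp
  qed
  have "S n = smult 2 (monom 1 n) \<and> S (Suc n) = smult 2 (monom 1 (Suc n))" for n
  proof (induction n)
    case 0
    have "lucas_op s q 1 = monom 1 1"
      using lucas_op_monom[OF q1, of s 0] by (simp add: monom_0 one_pCons)
    moreover have "gbinom q (Suc 0) 1 = 1" "gbinom q (Suc 0) 0 = 1" "gbinom q 0 0 = 1"
      using gbinom_0_right[OF q(1)] gbinom_sym[of q "Suc 0" 0] by simp_all
    ultimately show ?case
      by (simp add: S_def lucas_pair_def poly_at_op_lucas_0 poly_at_op_lucas_1 monom_0 one_pCons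
          smult_add_left[symmetric] mult_2[symmetric] del: lucas.simps)
        (simp add: smult_monom monom_Suc add_monom numeral_poly)
  next
    case (Suc n)
    then have "S (Suc (Suc n)) = smult 2 (monom 1 (Suc (Suc n)))"
      unfolding rec by (simp add: lucas_op_smult lucas_op_monom[OF q1] smult_diff_right mult.commute del: power_Suc)
    with Suc show ?case
      by simp
  qed
  then show ?thesis
    by (simp add: S_def)
qed

lemma sum_atMost_double_symmetric:
  fixes f :: "nat \<Rightarrow> 'a::comm_semiring_1"
  assumes "\<And>i. i \<le> 2 * n \<Longrightarrow> f (2 * n - i) = f i"
  shows "(\<Sum>i\<le>2 * n. f i) = (\<Sum>r\<le>n. (if r = 0 then 1 else 2) * f (n - r))"
proof -
  have "{..2 * n} = {..<n} \<union> ({n} \<union> {n<..2 * n})"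
    by auto
  then have "(\<Sum>i\<le>2 * n. f i) = sum f {..<n} + (f n + sum f {n<..2 * n})"
    by (simp add: sum.union_disjoint disjoint_iff add.left_commute)
  also have "sum f {..<n} = (\<Sum>r\<in>{1..n}. f (n - r))"
    by (rule sum.reindex_bij_witness[where i = "\<lambda>r. n - r" and j = "\<lambda>r. n - r"]) auto
  also have "sum f {n<..2 * n} = (\<Sum>r\<in>{1..n}. f (n - r))"
  proof (rule sum.reindex_bij_witness[where i = "\<lambda>r. n + r" and j = "\<lambda>i. i - n"])
    fix i assume "i \<in> {n<..2 * n}"
    then show "f (n - (i - n)) = f i"
      using assms[of i] by (simp add: mult_2)
  qed auto
  also have "{..n} = insert 0 {1..n}"
    by auto
  then have "(\<Sum>r\<le>n. (if r = 0 then 1 else 2) * f (n - r)) = f n + (\<Sum>r\<in>{1..n}. 2 * f (n - r))"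
    by simp
  then have "(\<Sum>r\<in>{1..n}. f (n - r)) + (f n + (\<Sum>r\<in>{1..n}. f (n - r))) =
      (\<Sum>r\<le>n. (if r = 0 then 1 else 2) * f (n - r))"
    by (simp add: mult_2 sum.distrib add_ac)
  finally show ?thesis .
qed

lemma qlucas_star_gbinom_sum:
  assumes q: "norm q < 1" "q \<noteq> 0"
  shows "(\<Sum>r\<le>n. q ^ r * qlucas_star (2 * r) 1 (- inverse q) q * gbinom q (2 * n) (int n - int r)) = q ^ n"
proof -
  define s where "s = - inverse q"
  define f where "f i = gbinom q (2 * n) (int i) * poly (lucas_pair s q i (2 * n - i)) 1" for i
  have f_sym: "f (2 * n - i) = f i" if "i \<le> 2 * n" for i
    using gbinom_sym[of q "2 * n" "int i"] that lucas_pair_sym[of s q i]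
    by (simp add: f_def)
  have "2 = (\<Sum>i\<le>2 * n. f i)"
    using arg_cong[OF gbinom_lucas_pair_sum[OF q, of "2 * n" s], of "\<lambda>p. poly p 1"]
    by (simp add: f_def poly_sum poly_monom)
  also have "\<dots> = (\<Sum>r\<le>n. (if r = 0 then 1 else 2) * f (n - r))"
    by (rule sum_atMost_double_symmetric) (rule f_sym)
  also have "\<dots> = (\<Sum>r\<le>n. 2 * inverse (q ^ n) *
      (q ^ r * qlucas_star (2 * r) 1 (- inverse q) q * gbinom q (2 * n) (int n - int r)))"
  proof (intro sum.cong refl)
    fix r assume "r \<in> {..n}"
    then have r: "r \<le> n"
      by simp
    have "(- s) ^ min (n - r) (2 * n - (n - r)) = inverse (q ^ n) * q ^ r"
      using r q by (simp add: s_def power_diff field_simps)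
    moreover have "(n - r - (2 * n - (n - r))) + (2 * n - (n - r) - (n - r)) = 2 * r"
      using r by simp
    ultimately have "poly (lucas_pair s q (n - r) (2 * n - (n - r))) 1 =
        inverse (q ^ n) * q ^ r * qlucas (2 * r) 1 s q"
      by (simp only: lucas_pair_def qlucas_def poly_smult)
    moreover have "int (n - r) = int n - int r"
      using r by simp
    ultimately have "(if r = 0 then 1 else 2) * f (n - r) =
        gbinom q (2 * n) (int n - int r) * (inverse (q ^ n) * q ^ r) *
        ((if r = 0 then 1 else 2) * qlucas (2 * r) 1 s q)"
      by (simp only: f_def mult_ac)
    \<comment> \<open>The middle term occurs once but carries L_0 = 2, all others occur twice; this
      is where the convention L*_0 = 1 enters.\<close>
    also have "(if r = 0 then 1 else 2) * qlucas (2 * r) 1 s q = 2 * qlucas_star (2 * r) 1 s q"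
      by (simp add: qlucas_star_def qlucas_def poly_at_op_lucas_0 del: lucas.simps)
    finally show "(if r = 0 then 1 else 2) * f (n - r) = 2 * inverse (q ^ n) *
      (q ^ r * qlucas_star (2 * r) 1 (- inverse q) q * gbinom q (2 * n) (int n - int r))"
      by (simp only: s_def mult_ac)
  qed
  also have "\<dots> = 2 * inverse (q ^ n) *
      (\<Sum>r\<le>n. q ^ r * qlucas_star (2 * r) 1 (- inverse q) q * gbinom q (2 * n) (int n - int r))"
    by (rule sum_distrib_left[symmetric])
  finally show ?thesis
    using q by (simp add: field_simps)
qed

section \<open>The values at \<open>x = 1\<close>, \<open>s = -1/q\<close>\<close>

text \<open>Used to turn sums over the integers into sums over the natural numbers, by grouping
  along an absolute value.\<close>

lemma has_sum_fibres:
  fixes F :: "'a \<Rightarrow> 'b::{topological_comm_monoid_add, t3_space}"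
  assumes F: "(F has_sum S) UNIV" and fin: "\<And>r. finite {j. \<phi> j = r}"
  shows "((\<lambda>r. \<Sum>j | \<phi> j = r. F j) has_sum S) UNIV"
proof (rule has_sum_SigmaD[where f = "\<lambda>(r, j). F j" and B = "\<lambda>r. {j. \<phi> j = r}"])
  show "((\<lambda>(r, j). F j) has_sum S) (Sigma UNIV (\<lambda>r. {j. \<phi> j = r}))"
    using F by (subst has_sum_reindex_bij_witness[where i = "\<lambda>j. (\<phi> j, j)" and j = snd
          and T = UNIV and h = F and s' = S]) auto
qed (use has_sum_finite[OF fin] in simp)

text \<open>By symmetry the lower indices n - 3j and n - 3j - 1 may be replaced by n - |3j| and n -
  |3j+1|; this is the total coefficient of [2n, n-r] in the bilateral sum. It turns out to be
  \<open>q^r\<close> times the \<open>q\<close>-Lucas value of index 2r.\<close>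

definition bilateral_coeff :: "complex \<Rightarrow> nat \<Rightarrow> complex" where
  "bilateral_coeff q r =
    (\<Sum>j | nat \<bar>3 * j\<bar> = r. q powi (6 * j\<^sup>2 + 2 * j)) -
    (\<Sum>j | nat \<bar>3 * j + 1\<bar> = r. q powi (6 * j\<^sup>2 + 2 * j))"

lemma fibre_subset:
  "{j::int. nat \<bar>3 * j\<bar> = r} \<subseteq> {int r div 3, - int r div 3}"
  "{j::int. nat \<bar>3 * j + 1\<bar> = r} \<subseteq> {(int r - 1) div 3, (- int r - 1) div 3}"
proof -
  have "j \<in> {int r div 3, - int r div 3}" if "nat \<bar>3 * j\<bar> = r" for j
  proof (cases "j \<ge> 0")
    case False
    then have "- int r = 3 * j" using that by linarith
    then show ?thesis by simp
  qed (use that in auto)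
  moreover have "j \<in> {(int r - 1) div 3, (- int r - 1) div 3}" if "nat \<bar>3 * j + 1\<bar> = r" for j
  proof (cases "j \<ge> 0")
    case True
    then have "int r - 1 = 3 * j" using that by linarith
    then show ?thesis by simp
  next
    case False
    then have "- int r - 1 = 3 * j" using that by linarith
    then show ?thesis by simp
  qed
  ultimately show "{j::int. nat \<bar>3 * j\<bar> = r} \<subseteq> {int r div 3, - int r div 3}"
    "{j::int. nat \<bar>3 * j + 1\<bar> = r} \<subseteq> {(int r - 1) div 3, (- int r - 1) div 3}"
    by blast+
qed

lemma finite_fibre:
  "finite {j::int. nat \<bar>3 * j\<bar> = r}" "finite {j::int. nat \<bar>3 * j + 1\<bar> = r}"
  by (rule finite_subset[OF fibre_subset(1)], simp) (rule finite_subset[OF fibre_subset(2)], simp)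

text \<open>The weight \<open>h\<close> is left open because two choices matter: Gaussian binomials
  for the linear system, and q^(r^2) for the theta series.\<close>

lemma has_sum_bilateral_coeff:
  assumes "(\<lambda>j. q powi (6 * j\<^sup>2 + 2 * j) * h (nat \<bar>3 * j\<bar>)) summable_on UNIV"
    and "(\<lambda>j. q powi (6 * j\<^sup>2 + 2 * j) * h (nat \<bar>3 * j + 1\<bar>)) summable_on UNIV"
  shows "((\<lambda>r. bilateral_coeff q r * h r) has_sum
    (\<Sum>\<^sub>\<infinity>j\<in>UNIV. q powi (6 * j\<^sup>2 + 2 * j) * (h (nat \<bar>3 * j\<bar>) - h (nat \<bar>3 * j + 1\<bar>)))) UNIV"
proof -
  have "bilateral_coeff q r * h r =
      (\<Sum>j | nat \<bar>3 * j\<bar> = r. q powi (6 * j\<^sup>2 + 2 * j) * h (nat \<bar>3 * j\<bar>)) -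
      (\<Sum>j | nat \<bar>3 * j + 1\<bar> = r. q powi (6 * j\<^sup>2 + 2 * j) * h (nat \<bar>3 * j + 1\<bar>))" for r
    by (simp add: bilateral_coeff_def left_diff_distrib sum_distrib_right)
  then show ?thesis
    using has_sum_diff[OF has_sum_fibres[OF has_sum_infsum[OF assms(1)] finite_fibre(1)]
        has_sum_fibres[OF has_sum_infsum[OF assms(2)] finite_fibre(2)]]
    by (simp add: right_diff_distrib infsum_diff assms)
qed

lemma bilateral_coeff_gbinom_sum:
  assumes q: "norm q < 1" "q \<noteq> 0"
  shows "(\<Sum>r\<le>n. bilateral_coeff q r * gbinom q (2 * n) (int n - int r)) = q ^ n"
proof -
  let ?g = "gbinom q (2 * n)"
  have sym: "?g (int n + k) = ?g (int n - k)" for k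
    using gbinom_sym[of q "2 * n" "int n - k"] by (simp add: algebra_simps)
  have abs: "?g (int n - \<bar>k\<bar>) = ?g (int n - k)" for k
    using sym[of k] by (simp add: abs_if)
  define h where "h r = ?g (int n - int r)" for r
  have h: "h (nat \<bar>k\<bar>) = ?g (int n - k)" for k
    by (simp add: h_def abs)
  have "((\<lambda>r. bilateral_coeff q r * h r) has_sum
    (\<Sum>\<^sub>\<infinity>j\<in>UNIV. q powi (6 * j\<^sup>2 + 2 * j) * (h (nat \<bar>3 * j\<bar>) - h (nat \<bar>3 * j + 1\<bar>)))) UNIV"
    by (rule has_sum_bilateral_coeff; unfold h; rule gbinom_summable) (auto simp: inj_def)
  also have "(\<Sum>\<^sub>\<infinity>j\<in>UNIV. q powi (6 * j\<^sup>2 + 2 * j) * (h (nat \<bar>3 * j\<bar>) - h (nat \<bar>3 * j + 1\<bar>))) = q ^ n"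
    using bilateral_gbinom[OF q, of n] by (simp add: h diff_diff_eq)
  finally have "((\<lambda>r. bilateral_coeff q r * h r) has_sum q ^ n) UNIV" .
  moreover have "((\<lambda>r. bilateral_coeff q r * h r) has_sum (\<Sum>r\<le>n. bilateral_coeff q r * h r)) UNIV"
    by (rule has_sum_finite_neutralI) (auto simp: h_def gbinom_eq_0)
  ultimately show ?thesis
    using has_sum_unique unfolding h_def by blast
qed

text \<open>Both sides solve the same unitriangular linear system, whose matrix is
  \<open>gbinom q (2 * n) (n - r)\<close>.\<close>

lemma qlucas_star_eq_bilateral_coeff:
  assumes q: "norm q < 1" "q \<noteq> 0"
  shows "q ^ n * qlucas_star (2 * n) 1 (- inverse q) q = bilateral_coeff q n"
proof (induction n rule: less_induct)
  case (less n)
  let ?x = "\<lambda>r. q ^ r * qlucas_star (2 * r) 1 (- inverse q) q"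
  have "(\<Sum>r\<le>n. ?x r * gbinom q (2 * n) (int n - int r)) =
      (\<Sum>r\<le>n. bilateral_coeff q r * gbinom q (2 * n) (int n - int r))"
    using qlucas_star_gbinom_sum[OF q] bilateral_coeff_gbinom_sum[OF q] by simp
  moreover have "(\<Sum>r<n. ?x r * gbinom q (2 * n) (int n - int r)) =
      (\<Sum>r<n. bilateral_coeff q r * gbinom q (2 * n) (int n - int r))"
    by (intro sum.cong refl) (simp add: less)
  ultimately show ?case
    using gbinom_0_right[OF q(1), of "2 * n"] by (simp flip: lessThan_Suc_atMost)
qed

section \<open>Bounds for the exponents and for \<open>bilateral_coeff\<close>\<close>

lemma exponent_nonneg: "6 * j\<^sup>2 + 2 * j \<ge> \<bar>j :: int\<bar>"
proof -
  have "\<bar>j\<bar> * 1 \<le> \<bar>j\<bar> * \<bar>j\<bar>" if "j \<noteq> 0"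
    using that by (intro mult_left_mono) auto
  then have "\<bar>j\<bar> \<le> j\<^sup>2"
    by (cases "j = 0") (auto simp: power2_eq_square simp flip: abs_mult)
  then show ?thesis
    by linarith
qed

lemma norm_powi_le:
  fixes q :: complex
  assumes "norm q < 1" "int m \<le> n"
  shows "norm (q powi n) \<le> norm q ^ m"
proof -
  have "q powi n = q ^ nat n"
    using assms(2) by (simp add: power_int_def)
  then show ?thesis
    using assms by (auto simp: norm_power intro!: power_decreasing)
qed

text \<open>Each of the two fibres has at most two elements, and every power in the sums has modulus
  at most 1.\<close>

lemma norm_bilateral_coeff_le:
  assumes "norm q < 1"
  shows "norm (bilateral_coeff q r) \<le> 4"
proof -
  have le: "norm (\<Sum>j\<in>A. q powi (6 * j\<^sup>2 + 2 * j)) \<le> 2" if "A \<subseteq> {a, b}" for A and a b :: int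
  proof -
    have "norm (\<Sum>j\<in>A. q powi (6 * j\<^sup>2 + 2 * j)) \<le> (\<Sum>j\<in>A. 1)"
    proof (rule sum_norm_le)
      show "norm (q powi (6 * j\<^sup>2 + 2 * j)) \<le> 1" for j
        using norm_powi_le[OF assms, of 0 "6 * j\<^sup>2 + 2 * j"] exponent_nonneg[of j] by simp
    qed
    also have "\<dots> \<le> 2"
      using card_mono[OF _ that] card_insert_le_m1[of 2 "{b}" a] by simp
    finally show ?thesis .
  qed
  show ?thesis
    unfolding bilateral_coeff_def
    by (rule order_trans[OF norm_triangle_ineq4])
      (use add_mono[OF le[OF fibre_subset(1)] le[OF fibre_subset(2)]] in simp)
qed

section \<open>Durfee rectangles and the interchange of summation\<close>

lemma qq_inf_properties:
  assumes "norm q < 1"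
  shows qq_tendsto: "qq q \<longlonglongrightarrow> qq_inf q" and qq_inf_nonzero: "qq_inf q \<noteq> 0"
proof -
  have nz: "1 - q ^ Suc j \<noteq> 0" for j
    by (rule one_minus_power_nonzero[OF assms]) simp
  have "convergent_prod (\<lambda>j. 1 + - (q ^ Suc j))"
  proof (rule summable_imp_convergent_prod_complex)
    show "summable (\<lambda>k. norm (- (q ^ Suc k)))"
      using assms by (simp add: norm_mult norm_power summable_mult)
    show "- (q ^ Suc k) \<noteq> - 1" for k
      using nz[of k] by auto
  qed
  then have conv: "convergent_prod (\<lambda>j. 1 - q ^ Suc j)"
    by simp
  show "qq_inf q \<noteq> 0"
    unfolding qq_inf_def by (rule prodinf_nonzero[OF conv nz])
  have "qq q (Suc n) = (\<Prod>i\<le>n. 1 - q ^ Suc i)" for n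
    by (induction n) (simp_all add: qq_Suc)
  then show "qq q \<longlonglongrightarrow> qq_inf q"
    using convergent_prod_LIMSEQ[OF conv] unfolding qq_inf_def
    by (subst filterlim_sequentially_Suc[symmetric]) simp
qed

lemma qq_inverse_bound:
  assumes "norm q < 1"
  obtains K where "K > 0" "\<And>n. norm (1 / qq q n) \<le> K"
proof -
  have "(\<lambda>n. 1 / qq q n) \<longlonglongrightarrow> 1 / qq_inf q"
    by (intro tendsto_intros qq_tendsto qq_inf_nonzero assms)
  then have "Bseq (\<lambda>n. 1 / qq q n)"
    by (intro convergent_imp_Bseq convergentI)
  then show thesis
    using that by (auto elim: BseqE)
qed

text \<open>Combinatorially, each partition contains a unique largest m by (m + a) rectangle. The
  proof is analytic instead: the sum \<open>f a\<close> does not depend on \<open>a\<close>, and its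
  limit is computed.\<close>

lemma durfee_rectangle:
  assumes q: "norm q < 1"
  shows "(\<lambda>m. q ^ (m\<^sup>2 + a * m) / (qq q m * qq q (m + a))) sums (1 / qq_inf q)"
proof -
  obtain K where K: "K > 0" "\<And>n. norm (1 / qq q n) \<le> K"
    using qq_inverse_bound[OF q] by blast
  define t where "t a m = q ^ (m\<^sup>2 + a * m) / (qq q m * qq q (m + a))" for a m
  define f where "f a = suminf (t a)" for a
  note nz = qq_nonzero[OF q]
  have t_le: "norm (t a m) \<le> K\<^sup>2 * norm q ^ k" if "k \<le> m\<^sup>2 + a * m" for a m k
  proof -
    have "norm (t a m) = norm (1 / qq q m) * norm (1 / qq q (m + a)) * norm q ^ (m\<^sup>2 + a * m)"
      by (simp add: t_def norm_divide norm_mult norm_power)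
    also have "\<dots> \<le> K * K * norm q ^ k"
      using K q that by (intro mult_mono power_decreasing) auto
    finally show ?thesis
      by (simp add: power2_eq_square)
  qed
  have geo: "summable (\<lambda>m. K\<^sup>2 * norm q ^ m)" for K :: real
    using q by (intro summable_mult summable_geometric) simp
  have le_sq: "m \<le> m\<^sup>2 + a * m" for m a :: nat
    by (cases m) (auto simp: power2_eq_square)
  have t_sums: "t a sums f a" for a
    unfolding f_def
    by (intro summable_sums summable_comparison_test'[OF geo[of K], of 0]) (use t_le le_sq in blast)
  have f_le: "norm (f a) \<le> (\<Sum>m. K\<^sup>2 * norm q ^ m)" for a
    unfolding f_def by (intro norm_suminf_le geo) (use t_le le_sq in blast)
  define d where "d a = f a - f (Suc a)" for a
  \<comment> \<open>Iterating this recurrence makes \<open>d a\<close> smaller than any power of \<open>norm q\<close>, hence \<open>d = 0\<close> and \<open>f\<close>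
    is constant; its value is then read off as \<open>a\<close> tends to infinity.\<close>
  have d_Suc: "d a = - (q ^ Suc a * d (Suc a))" for a
  proof -
    \<comment> \<open>\<open>P\<close> is summed in two ways: termwise through \<open>t a\<close>
      and \<open>t (Suc a)\<close>, and, since its term at \<open>m = 0\<close> vanishes, after an
      index shift through \<open>t (Suc (Suc a))\<close>.\<close>
    define P where "P m = q ^ (m\<^sup>2 + a * m) * (1 - q ^ m) / (qq q m * qq q (m + Suc a))" for m
    have P_eq: "P m = t a m - t (Suc a) m + q ^ Suc a * t (Suc a) m" for m
    proof -
      have "t a m = q ^ (m\<^sup>2 + a * m) * (1 - q ^ (m + Suc a)) / (qq q m * qq q (m + Suc a))"
        using nz one_minus_power_nonzero[OF q, of "m + Suc a"]
        by (simp add: t_def qq_Suc del: power_Suc)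
      moreover have "t (Suc a) m = q ^ (m\<^sup>2 + a * m) * q ^ m / (qq q m * qq q (m + Suc a))"
        by (simp add: t_def power_add mult_ac)
      ultimately show ?thesis
        by (simp add: P_def power_add diff_divide_distrib[symmetric] add_divide_distrib[symmetric] algebra_simps)
    qed
    have "P sums (f a - f (Suc a) + q ^ Suc a * f (Suc a))"
      unfolding P_eq by (intro sums_add sums_diff sums_mult t_sums)
    moreover have "P sums (q ^ Suc a * f (Suc (Suc a)))"
    proof -
      have "P (Suc m) = q ^ Suc a * t (Suc (Suc a)) m" for m
      proof -
        have "P (Suc m) = q ^ ((Suc m)\<^sup>2 + a * Suc m) / (qq q m * qq q (m + Suc (Suc a)))"
          using nz one_minus_power_nonzero[OF q, of "Suc m"]
          by (simp add: P_def qq_Suc[of q m] del: power_Suc)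
        also have "(Suc m)\<^sup>2 + a * Suc m = Suc a + (m\<^sup>2 + Suc (Suc a) * m)"
          by (simp add: power2_eq_square algebra_simps)
        finally show ?thesis
          by (simp only: t_def power_add times_divide_eq_right)
      qed
      then have "(\<lambda>m. P (Suc m)) sums (q ^ Suc a * f (Suc (Suc a)))"
        by (simp only: sums_mult t_sums)
      then show ?thesis
        by (subst (asm) sums_Suc_iff) (simp add: P_def)
    qed
    ultimately have "f a - f (Suc a) + q ^ Suc a * f (Suc a) = q ^ Suc a * f (Suc (Suc a))"
      by (rule sums_unique2)
    then show ?thesis
      by (simp add: d_def algebra_simps)
  qed
  have d_0: "d a = 0" for a
  proof -
    define C where "C = 2 * (\<Sum>m. K\<^sup>2 * norm q ^ m)"
    have d_le: "norm (d a) \<le> C" for a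
      unfolding d_def C_def using norm_triangle_ineq4[of "f a" "f (Suc a)"] f_le[of a] f_le[of "Suc a"]
      by linarith
    have step: "norm (d a) \<le> norm q * norm (d (Suc a))" for a
    proof -
      have "norm (d a) = norm q ^ Suc a * norm (d (Suc a))"
        by (subst d_Suc) (simp add: norm_mult norm_power)
      also have "\<dots> \<le> norm q ^ 1 * norm (d (Suc a))"
        using q by (intro mult_right_mono power_decreasing) auto
      finally show ?thesis by simp
    qed
    have "norm (d a) \<le> norm q ^ n * norm (d (a + n))" for n
    proof (induction n)
      case (Suc n)
      also have "norm q ^ n * norm (d (a + n)) \<le> norm q ^ n * (norm q * norm (d (Suc (a + n))))"
        by (intro mult_left_mono step) simp
      finally show ?case
        by (simp add: mult_ac)
    qed simp
    then have "norm (d a) \<le> norm q ^ n * C" for n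
      using d_le[of "a + n"] by (meson mult_left_mono norm_ge_zero order_trans zero_le_power)
    moreover have "(\<lambda>n. norm q ^ n * C) \<longlonglongrightarrow> 0 * C"
      using q by (intro tendsto_intros) auto
    ultimately have "norm (d a) \<le> 0 * C"
      by (intro LIMSEQ_le_const) auto
    then show ?thesis
      by simp
  qed
  have f_const: "f a = f 0" for a
    by (induction a) (use d_0 in \<open>auto simp: d_def\<close>)
  \<comment> \<open>For large \<open>a\<close> only the term \<open>m = 0\<close>, which is
    1/(q;q)_a, survives: all later exponents are at least \<open>a\<close>.\<close>
  have "(\<lambda>a. f a - 1 / qq q a) \<longlonglongrightarrow> 0"
  proof (rule Lim_null_comparison)
    show "(\<lambda>a. norm q ^ a * (\<Sum>m. K\<^sup>2 * norm q ^ m)) \<longlonglongrightarrow> 0"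
      using q by (intro tendsto_mult_left_zero LIMSEQ_power_zero) simp
    show "\<forall>\<^sub>F a in sequentially. norm (f a - 1 / qq q a) \<le> norm q ^ a * (\<Sum>m. K\<^sup>2 * norm q ^ m)"
    proof (intro always_eventually allI)
      fix a
      have "(\<lambda>m. t a (Suc m)) sums (f a - t a 0)"
        using t_sums[of a] by (subst sums_Suc_iff) simp
      then have "f a - 1 / qq q a = (\<Sum>m. t a (Suc m))"
        by (simp add: sums_iff t_def)
      also have "norm \<dots> \<le> (\<Sum>m. norm q ^ a * (K\<^sup>2 * norm q ^ m))"
      proof (rule norm_suminf_le)
        show "summable (\<lambda>m. norm q ^ a * (K\<^sup>2 * norm q ^ m))"
          by (intro summable_mult geo)
        show "norm (t a (Suc m)) \<le> norm q ^ a * (K\<^sup>2 * norm q ^ m)" for m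
          using t_le[of "a + m" "Suc m" a] by (simp add: power2_eq_square power_add mult_ac)
      qed
      also have "\<dots> = norm q ^ a * (\<Sum>m. K\<^sup>2 * norm q ^ m)"
        by (rule suminf_mult[OF geo])
      finally show "norm (f a - 1 / qq q a) \<le> norm q ^ a * (\<Sum>m. K\<^sup>2 * norm q ^ m)" .
    qed
  qed
  moreover have "(\<lambda>a. f a - 1 / qq q a) = (\<lambda>a. f 0 - 1 / qq q a)"
    by (rule ext, subst f_const, rule refl)
  moreover have "(\<lambda>a. f 0 - 1 / qq q a) \<longlonglongrightarrow> f 0 - 1 / qq_inf q"
    by (intro tendsto_intros qq_tendsto qq_inf_nonzero q)
  ultimately have "f 0 - 1 / qq_inf q = 0"
    using LIMSEQ_unique by (simp only:)
  then have "f 0 = 1 / qq_inf q"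
    by simp
  then show ?thesis
    using t_sums[of a] f_const[of a] by (simp add: t_def[abs_def])
qed

section \<open>Absolute convergence and the double series\<close>

lemma summable_on_power_abs_int:
  assumes "0 \<le> x" "x < (1::real)"
  shows "(\<lambda>j::int. x ^ nat \<bar>j\<bar>) summable_on UNIV"
proof -
  have geo: "(\<lambda>n. x ^ n) summable_on UNIV"
    using assms by (intro norm_summable_imp_summable_on) (simp add: summable_geometric)
  have "(\<lambda>j::int. x ^ nat \<bar>j\<bar>) summable_on range int"
    by (subst summable_on_reindex) (simp_all add: o_def geo)
  moreover have "(\<lambda>j::int. x ^ nat \<bar>j\<bar>) summable_on range (\<lambda>n. - int n)"
    by (subst summable_on_reindex) (simp_all add: o_def geo inj_def)
  moreover have "UNIV = range int \<union> range (\<lambda>n. - int n)"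
    using int_cases2 by blast
  ultimately show ?thesis
    by (metis summable_on_union)
qed

lemma summable_on_power_times:
  assumes "0 \<le> x" "x < (1::real)"
  shows "(\<lambda>(r, m). x ^ r * x ^ m) summable_on UNIV \<times> (UNIV :: nat set)"
proof (rule summable_on_SigmaI)
  have geo: "((\<lambda>m. x ^ m) has_sum (1 / (1 - x))) UNIV"
    using assms geometric_sums[of x] by (intro norm_summable_imp_has_sum) (simp_all add: summable_geometric)
  show "((\<lambda>m. case (r, m) of (r, m) \<Rightarrow> x ^ r * x ^ m) has_sum (x ^ r * (1 / (1 - x)))) UNIV" for r
    using has_sum_cmult_right[OF geo] by simp
  show "(\<lambda>r. x ^ r * (1 / (1 - x))) summable_on UNIV"
    using geo by (intro summable_on_cmult_left) (auto simp: summable_on_def)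
qed (use assms in auto)

lemma summable_on_powi_quadratic:
  fixes q :: complex
  assumes "norm q < 1" "\<And>j. \<bar>j\<bar> \<le> e j"
  shows "(\<lambda>j::int. q powi e j) summable_on UNIV"
  by (rule abs_summable_summable, rule Infinite_Sum.abs_summable_on_comparison_test'[OF
        summable_on_power_abs_int[OF norm_ge_zero assms(1)]])
    (rule norm_powi_le[OF assms(1)], simp add: assms(2))

lemma bilateral_coeff_theta:
  assumes q: "norm q < 1" "q \<noteq> 0"
  shows "(\<lambda>j. q powi (15 * j\<^sup>2 + 2 * j) - q powi (15 * j\<^sup>2 + 8 * j + 1)) summable_on UNIV"
    and "((\<lambda>r. bilateral_coeff q r * q ^ r\<^sup>2) has_sum
      (\<Sum>\<^sub>\<infinity>j\<in>UNIV. q powi (15 * j\<^sup>2 + 2 * j) - q powi (15 * j\<^sup>2 + 8 * j + 1))) UNIV"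
proof -
  have h: "q ^ (nat \<bar>k\<bar>)\<^sup>2 = q powi (k\<^sup>2)" for k :: int
    using power_int_of_nat[of q "(nat \<bar>k\<bar>)\<^sup>2"] by simp
  have 1: "q powi (6 * j\<^sup>2 + 2 * j) * q ^ (nat \<bar>3 * j\<bar>)\<^sup>2 = q powi (15 * j\<^sup>2 + 2 * j)" for j
    unfolding h using q by (simp flip: power_int_add add: power_mult_distrib algebra_simps)
  have 2: "q powi (6 * j\<^sup>2 + 2 * j) * q ^ (nat \<bar>3 * j + 1\<bar>)\<^sup>2 = q powi (15 * j\<^sup>2 + 8 * j + 1)" for j
    unfolding h using q by (simp flip: power_int_add add: power2_eq_square algebra_simps)
  have s1: "(\<lambda>j. q powi (15 * j\<^sup>2 + 2 * j)) summable_on UNIV"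
  proof (rule summable_on_powi_quadratic[OF q(1)])
    fix j :: int
    show "\<bar>j\<bar> \<le> 15 * j\<^sup>2 + 2 * j"
      using exponent_nonneg[of j] zero_le_power2[of j] by linarith
  qed
  have s2: "(\<lambda>j. q powi (15 * j\<^sup>2 + 8 * j + 1)) summable_on UNIV"
  proof (rule summable_on_powi_quadratic[OF q(1)])
    fix j :: int
    have "(3 * j + 1)\<^sup>2 = 9 * j\<^sup>2 + 6 * j + 1"
      by (simp add: power2_eq_square algebra_simps)
    then show "\<bar>j\<bar> \<le> 15 * j\<^sup>2 + 8 * j + 1"
      using exponent_nonneg[of j] zero_le_power2[of "3 * j + 1"] by linarith
  qed
  show "(\<lambda>j. q powi (15 * j\<^sup>2 + 2 * j) - q powi (15 * j\<^sup>2 + 8 * j + 1)) summable_on UNIV"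
    by (rule summable_on_diff[OF s1 s2])
  show "((\<lambda>r. bilateral_coeff q r * q ^ r\<^sup>2) has_sum
      (\<Sum>\<^sub>\<infinity>j\<in>UNIV. q powi (15 * j\<^sup>2 + 2 * j) - q powi (15 * j\<^sup>2 + 8 * j + 1))) UNIV"
    using has_sum_bilateral_coeff[of q "\<lambda>r. q ^ r\<^sup>2"] s1 s2
    by (simp add: 1 2 right_diff_distrib)
qed

text \<open>A limiting case of Bailey's lemma. The double series \<open>G\<close> is summed over
  \<open>m\<close> for fixed \<open>r\<close> by Durfee rectangles with \<open>a = 2 * r\<close>,
  and along the diagonals r + m = n by the expansion of q^n; the common value is
  \<open>S\<close>.\<close>

lemma bilateral_coeff_bailey:
  assumes q: "norm q < 1" "q \<noteq> 0"
  obtains S where "((\<lambda>n. q ^ (n\<^sup>2 + n) / qq q (2 * n)) has_sum S) UNIV"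
    and "((\<lambda>r. bilateral_coeff q r * q ^ r\<^sup>2 * (1 / qq_inf q)) has_sum S) UNIV"
proof -
  define G where
    "G = (\<lambda>(r, m). q ^ (r + m)\<^sup>2 * bilateral_coeff q r / (qq q m * qq q (m + 2 * r)))"
  note nz = qq_nonzero[OF q(1)]
  obtain K where K: "K > 0" "\<And>n. norm (1 / qq q n) \<le> K"
    using qq_inverse_bound[OF q(1)] by blast
  have G_summable: "G summable_on UNIV \<times> UNIV"
  \<comment> \<open>The majorant is 4 K^2 |q|^(r+m), from the bound 4 on the coefficients, the
    uniform bound \<open>K\<close> on 1/(q;q)_n, and r + m <= (r+m)^2.\<close>
  proof (rule abs_summable_summable, rule Infinite_Sum.abs_summable_on_comparison_test')
    have "(\<lambda>(r, m). norm q ^ r * norm q ^ m) summable_on UNIV \<times> (UNIV :: nat set)"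
      by (rule summable_on_power_times[OF norm_ge_zero q(1)])
    then show "(\<lambda>x. 4 * K\<^sup>2 * (case x of (r, m) \<Rightarrow> norm q ^ r * norm q ^ m)) summable_on UNIV \<times> UNIV"
      by (rule summable_on_cmult_right)
    fix x :: "nat \<times> nat"
    obtain r m where x: "x = (r, m)"
      by (cases x)
    have "r + m \<le> (r + m)\<^sup>2"
      by (simp add: power2_nat_le_imp_le power2_eq_square)
    have "norm (G x) = norm (bilateral_coeff q r) *
        (norm (1 / qq q m) * norm (1 / qq q (m + 2 * r))) * norm q ^ (r + m)\<^sup>2"
      by (simp add: G_def x norm_divide norm_mult norm_power)
    also have "\<dots> \<le> 4 * (K * K) * norm q ^ (r + m)"
      using K q \<open>r + m \<le> (r + m)\<^sup>2\<close>
      by (intro mult_mono power_decreasing norm_bilateral_coeff_le) auto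
    finally show "norm (G x) \<le> 4 * K\<^sup>2 * (case x of (r, m) \<Rightarrow> norm q ^ r * norm q ^ m)"
      by (simp add: x power2_eq_square power_add)
  qed
  define S where "S = infsum G (UNIV \<times> UNIV)"
  have G_sum: "(G has_sum S) (UNIV \<times> UNIV)"
    unfolding S_def by (rule has_sum_infsum[OF G_summable])
  show thesis
  proof
    show "((\<lambda>r. bilateral_coeff q r * q ^ r\<^sup>2 * (1 / qq_inf q)) has_sum S) UNIV"
    proof (rule has_sum_SigmaD[OF G_sum])
      fix r
      have "(\<lambda>m. G (r, m)) summable_on UNIV"
        using summable_on_SigmaD1[of "curry G" UNIV "\<lambda>_. UNIV" r] G_summable by (simp add: curry_def)
      then obtain T where T: "((\<lambda>m. G (r, m)) has_sum T) UNIV"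
        by (auto simp: summable_on_def)
      have "(\<lambda>m. G (r, m)) sums (bilateral_coeff q r * q ^ r\<^sup>2 * (1 / qq_inf q))"
      proof -
        have "G (r, m) = bilateral_coeff q r * q ^ r\<^sup>2 *
            (q ^ (m\<^sup>2 + 2 * r * m) / (qq q m * qq q (m + 2 * r)))" for m
        proof -
          have "(r + m)\<^sup>2 = r\<^sup>2 + (m\<^sup>2 + 2 * r * m)"
            by (simp add: power2_sum)
          then show ?thesis
            by (simp add: G_def power_add)
        qed
        then show ?thesis
          by (simp only: sums_mult durfee_rectangle[OF q(1)])
      qed
      then show "((\<lambda>m. G (r, m)) has_sum (bilateral_coeff q r * q ^ r\<^sup>2 * (1 / qq_inf q))) UNIV"
        using has_sum_imp_sums[OF T] T sums_unique2 by metis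
    qed
  next
    show "((\<lambda>n. q ^ (n\<^sup>2 + n) / qq q (2 * n)) has_sum S) UNIV"
    proof (rule has_sum_SigmaD)
      show "((\<lambda>(n, r). G (r, n - r)) has_sum S) (SIGMA n:UNIV. {..n})"
        using G_sum
        by (subst has_sum_reindex_bij_witness[where i = "\<lambda>(r, m). (r + m, r)"
              and j = "\<lambda>(n, r). (r, n - r)" and T = "UNIV \<times> UNIV" and h = G and s' = S]) auto
      fix n
      have "(\<Sum>r\<le>n. G (r, n - r)) =
          (\<Sum>r\<le>n. q ^ n\<^sup>2 / qq q (2 * n) * (bilateral_coeff q r * gbinom q (2 * n) (int n - int r)))"
      proof (intro sum.cong refl)
        fix r assume "r \<in> {..n}"
        then have r: "int n - int r = int (n - r)" "r + (n - r) = n" "n - r + 2 * r = n + r"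
            "2 * n - (n - r) = n + r" "n - r \<le> 2 * n"
          by auto
        \<comment> \<open>On the diagonal the denominators have indices n - r and n + r; they are
          those of [2n, n-r], whose numerator is compensated by 1/(q;q)_(2n).\<close>
        show "G (r, n - r) =
            q ^ n\<^sup>2 / qq q (2 * n) * (bilateral_coeff q r * gbinom q (2 * n) (int n - int r))"
          unfolding G_def gbinom_def r(1) using r nz[of "2 * n"]
          by (simp add: add.commute del: of_nat_diff)
      qed
      also have "\<dots> = q ^ (n\<^sup>2 + n) / qq q (2 * n)"
        by (simp only: sum_distrib_left[symmetric] bilateral_coeff_gbinom_sum[OF q] power_add)
          (rule times_divide_eq_left)
      finally show "((\<lambda>r. case (n, r) of (n, r) \<Rightarrow> G (r, n - r)) has_sum q ^ (n\<^sup>2 + n) / qq q (2 * n)) {..n}"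
        using has_sum_finite[of "{..n}" "\<lambda>r. G (r, n - r)"] by simp
    qed
  qed
qed

theorem corollary5p3:
  fixes q :: complex
  assumes "0 < norm q" and "norm q < 1"
  shows "summable (\<lambda>n. q ^ (n\<^sup>2 + n) / qq q (2 * n)) \<and>
    summable (\<lambda>k. qlucas_star (2 * k) 1 (- inverse q) q * q ^ (k\<^sup>2 + k)) \<and>
    (\<lambda>k::int. q powi (15 * k\<^sup>2 + 2 * k) - q powi (15 * k\<^sup>2 + 8 * k + 1)) summable_on UNIV \<and>
    (\<Sum>n. q ^ (n\<^sup>2 + n) / qq q (2 * n)) =
      1 / qq_inf q * (\<Sum>k. qlucas_star (2 * k) 1 (- inverse q) q * q ^ (k\<^sup>2 + k)) \<and>
    1 / qq_inf q * (\<Sum>k. qlucas_star (2 * k) 1 (- inverse q) q * q ^ (k\<^sup>2 + k)) =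
      1 / qq_inf q *
        (\<Sum>\<^sub>\<infinity>k::int\<in>UNIV. q powi (15 * k\<^sup>2 + 2 * k) - q powi (15 * k\<^sup>2 + 8 * k + 1))"
proof -
  have q: "norm q < 1" "q \<noteq> 0"
    using assms by auto
  define \<Theta> where "\<Theta> = (\<Sum>\<^sub>\<infinity>k::int\<in>UNIV. q powi (15 * k\<^sup>2 + 2 * k) - q powi (15 * k\<^sup>2 + 8 * k + 1))"
  \<comment> \<open>The factor q^k of the weight turns the \<open>q\<close>-Lucas value into the
    bilateral coefficient.\<close>
  have "qlucas_star (2 * k) 1 (- inverse q) q * q ^ (k\<^sup>2 + k) = bilateral_coeff q k * q ^ k\<^sup>2" for k
    unfolding qlucas_star_eq_bilateral_coeff[OF q, symmetric] by (simp add: power_add)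
  moreover have theta: "(\<lambda>k. bilateral_coeff q k * q ^ k\<^sup>2) sums \<Theta>"
    unfolding \<Theta>_def by (rule has_sum_imp_sums[OF bilateral_coeff_theta(2)[OF q]])
  ultimately have lucas: "(\<lambda>k. qlucas_star (2 * k) 1 (- inverse q) q * q ^ (k\<^sup>2 + k)) sums \<Theta>"
    by simp
  obtain S where S: "((\<lambda>n. q ^ (n\<^sup>2 + n) / qq q (2 * n)) has_sum S) UNIV"
    "((\<lambda>r. bilateral_coeff q r * q ^ r\<^sup>2 * (1 / qq_inf q)) has_sum S) UNIV"
    using bilateral_coeff_bailey[OF q] by blast
  have "S = \<Theta> * (1 / qq_inf q)"
    using sums_unique2[OF has_sum_imp_sums[OF S(2)] sums_mult2[OF theta]] .
  then show ?thesis
    using has_sum_imp_sums[OF S(1)] lucas bilateral_coeff_theta(1)[OF q]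
    by (simp add: sums_iff \<Theta>_def)
qed

end
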